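(* Let $k$ and $l$ be positive integers and let $N = \left(\frac{2}{3}\right)^k\left(2^l +1\right)-1$. If $N$ is an odd integer, then the Collatz sequence starting with $N$ reaches $1$ in $l+k$ steps, i.e. $T^{l+k}(N)=1$.
   Context: The Collatz map $T$ on positive integers is $T(n)=n/2$ if $n$ is even and $T(n)=(3n+1)/2$ if $n$ is odd. The Collatz sequence starting with $N$ is $N, T(N), T^2(N),\dots$, continued indefinitely. One step is one application of $T$; $N$ reaches a value $m$ in $s$ steps if $T^s(N)=m$ (this is not required to be the first occurrence of $m$). *)

theory Defs
  imports Complex_Main
begin

text \<open>The positive integers are rendered by \<^typ>\<open>nat\<close>. The extra point \<open>0\<close> is a fixed point of the
  map and is not in the orbit of any positive number.\<close>

definition collatz :: "nat \<Rightarrow> nat" where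
  "collatz n = (if even n then n div 2 else (3 * n + 1) div 2)"

end

theory Submission imports Defs begin

text \<open>Since \<open>3\<^sup>k (N + 1) = 2\<^sup>k (2\<^sup>l + 1)\<close> and \<open>3\<^sup>k\<close> is coprime to \<open>2\<^sup>k\<close>, we have \<open>N = 2\<^sup>k m - 1\<close>
  with \<open>3\<^sup>k m = 2\<^sup>l + 1\<close>. Each odd step trades one factor 2 of \<open>N + 1\<close> for a factor 3, so \<open>k\<close> steps
  lead to \<open>3\<^sup>k m - 1 = 2\<^sup>l\<close>, and \<open>l\<close> halvings lead to 1.\<close>

lemma collatz_double: "collatz (2 * n) = n"
  by (simp add: collatz_def)

text \<open>At \<open>n = 0\<close> truncated subtraction makes both sides 0; otherwise
  \<open>2 * n - 1\<close> is odd and (3(2n - 1) + 1)/2 = 3n - 1.\<close>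

lemma collatz_double_minus_1: "collatz (2 * n - 1) = 3 * n - 1"
  by (cases n) (simp_all add: collatz_def)

lemma funpow_collatz_power2: "(collatz ^^ l) (2 ^ l) = 1"
  by (induction l) (simp_all add: funpow_Suc_right collatz_double del: funpow.simps(2))

lemma funpow_collatz_power2_mult_minus_1:
  "(collatz ^^ k) (2 ^ k * m - 1) = 3 ^ k * m - 1"
proof (induction k arbitrary: m)
  case 0
  show ?case by simp
next
  case (Suc k)
  have "(collatz ^^ Suc k) (2 ^ Suc k * m - 1) = (collatz ^^ k) (collatz (2 * (2 ^ k * m) - 1))"
    by (simp add: funpow_Suc_right mult.assoc del: funpow.simps(2))
  \<comment> \<open>The new factor 3 is absorbed into the multiplier, so the induction hypothesis
    applies at \<open>3 * m\<close>.\<close>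
  also have "\<dots> = (collatz ^^ k) (2 ^ k * (3 * m) - 1)"
    by (simp only: collatz_double_minus_1 mult.left_commute)
  also have "\<dots> = 3 ^ Suc k * m - 1"
    unfolding Suc.IH by (simp only: power_Suc mult_ac)
  finally show ?case .
qed

theorem corollary2:
  fixes k l :: nat and N :: int
  assumes "k > 0" and "l > 0"
    and "real_of_int N = (2 / 3) ^ k * (2 ^ l + 1) - 1"
    and "odd N"
  shows "(collatz ^^ (l + k)) (nat N) = 1"
proof -
  have "real_of_int (3 ^ k * (N + 1)) = real_of_int (2 ^ k * (2 ^ l + 1))"
    using assms(3) by (simp add: power_divide)
  then have eq: "3 ^ k * (N + 1) = 2 ^ k * (2 ^ l + 1)"
    by (simp only: of_int_eq_iff)
  have "coprime (3 ^ k) (2 ^ k :: int)"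
    by simp
  moreover have "(3 ^ k :: int) dvd 2 ^ k * (2 ^ l + 1)"
    using eq by (metis dvd_triv_left)
  ultimately have "(3 ^ k :: int) dvd 2 ^ l + 1"
    by (simp only: coprime_dvd_mult_right_iff)
  then obtain M :: int where M: "2 ^ l + 1 = 3 ^ k * M" ..
  \<comment> \<open>Positivity of \<open>M\<close> lets the identity move to \<open>nat\<close>,
    where \<open>collatz\<close> acts.\<close>
  have "0 < 3 ^ k * M"
    unfolding M[symmetric] by (simp add: add_pos_pos)
  then have "M > 0"
    by (simp add: zero_less_mult_iff)
  then obtain m where m: "M = int m"
    using pos_int_cases by blast
  have "int (2 ^ l + 1) = int (3 ^ k * m)"
    using M m by simp
  then have l: "2 ^ l + 1 = 3 ^ k * m"
    by (simp only: of_nat_eq_iff)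
  have "N = int (2 ^ k * m) - 1"
    using eq M m by simp
  then have "nat N = 2 ^ k * m - 1"
    by linarith
  then have "(collatz ^^ k) (nat N) = 2 ^ l"
    by (simp only: funpow_collatz_power2_mult_minus_1 l[symmetric] add_diff_cancel_right')
  \<comment> \<open>\<open>funpow_add\<close> splits \<open>l + k\<close> so that the
    \<open>k\<close> odd steps act first.\<close>
  then show ?thesis
    by (simp add: funpow_add funpow_collatz_power2)
qed

end
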